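(* Let $h:\mathbb{R}^n\to\mathbb{R}$ be convex and absolutely homogeneous, let $g:\mathbb{R}^n\to\mathbb{R}$ be smooth, and let $\boldsymbol{x}_k\in\mathcal{S}$. Then the mapping $t=\phi(t')$ from the proxy step-size $t'$ to the actual step-size $t$ is monotonically increasing for $|t'|<1/h(\boldsymbol{x}_k)$, that is, $(\phi(t'_1)-\phi(t'_2))(t'_1-t'_2)\ge 0$ for all $t'_1,t'_2$ with $|t'_1|,|t'_2|<1/h(\boldsymbol{x}_k)$; and $\phi(0)=0$.
   Context: $\mathcal{S}=\{\boldsymbol{x}\in\mathbb{R}^n:\|\boldsymbol{x}\|_2=1\}$ is the unit sphere. The Riemannian gradient of $g$ at $\boldsymbol{x}\in\mathcal{S}$ is $\mathrm{grad}\,g|_{\boldsymbol{x}}=(\boldsymbol{I}-\boldsymbol{x}\boldsymbol{x}^{\mathsf T})\nabla g|_{\boldsymbol{x}}$, where $\nabla g$ is the Euclidean gradient. A function $h$ is absolutely homogeneous if $h(\alpha\boldsymbol{x})=|\alpha|h(\boldsymbol{x})$ for all scalars $\alpha$ and vectors $\boldsymbol{x}$. For $s\ge 0$, $\mathrm{prox}_{sh}(\boldsymbol{w})=\arg\min_{\boldsymbol{x}}\{s\,h(\boldsymbol{x})+\frac12\|\boldsymbol{x}-\boldsymbol{w}\|_2^2\}$ (so $\mathrm{prox}_{0h}(\boldsymbol{w})=\boldsymbol{w}$). For $t'\in\mathbb{R}$ define $c(t')=\boldsymbol{x}_k^{\mathsf T}\,\mathrm{prox}_{|t'|h}\left(\boldsymbol{x}_k-t'\,\mathrm{grad}\,g|_{\boldsymbol{x}_k}\right)$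 and $\phi(t')=t'/c(t')$ wherever $c(t')\neq 0$. Convention: $1/h(\boldsymbol{x}_k)=+\infty$ if $h(\boldsymbol{x}_k)=0$. "Monotonically increasing" is in the non-strict sense. *)

theory Defs
  imports "HOL-Analysis.Analysis"
begin

definition gradient :: "(real^'n \<Rightarrow> real) \<Rightarrow> real^'n \<Rightarrow> real^'n" where
  "gradient g x = (THE D. GDERIV g x :> D)"

lemma gradient_eqI: "GDERIV g x :> D \<Longrightarrow> gradient g x = D"
  unfolding gradient_def
proof (rule the_equality)
  fix D' assume a: "GDERIV g x :> D" and b: "GDERIV g x :> D'"
  have "(\<lambda>h. h \<bullet> D') = (\<lambda>h. h \<bullet> D)"
    using a b unfolding gderiv_def by (metis has_derivative_unique)
  then show "D' = D" by (metis vector_eq_ldot)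
qed

(* Smoothness as continuous differentiability, the weakest of the customary readings;
   it covers functions with Lipschitz gradient and infinitely differentiable functions. *)
definition smooth :: "(real^'n \<Rightarrow> real) \<Rightarrow> bool" where
  "smooth g \<longleftrightarrow> (\<forall>x. g differentiable (at x)) \<and> continuous_on UNIV (gradient g)"

definition riemannian_grad :: "(real^'n \<Rightarrow> real) \<Rightarrow> real^'n \<Rightarrow> real^'n" where
  "riemannian_grad g x = (mat 1 - (\<chi> i j. x $ i * x $ j)) *v gradient g x"

lemma riemannian_grad_eq:
  "riemannian_grad g x = gradient g x - (x \<bullet> gradient g x) *\<^sub>R x"
proof -
  have "(\<chi> i j. x $ i * x $ j) *v v = (x \<bullet> v) *\<^sub>R x" for v
    by (simp add: vec_eq_iff matrix_vector_mult_def inner_vec_def sum_distrib_left mult_ac)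
  then show ?thesis
    by (simp add: riemannian_grad_def matrix_vector_mult_diff_rdistrib)
qed

definition absolutely_homogeneous :: "(real^'n \<Rightarrow> real) \<Rightarrow> bool" where
  "absolutely_homogeneous h \<longleftrightarrow> (\<forall>\<alpha> x. h (\<alpha> *\<^sub>R x) = \<bar>\<alpha>\<bar> * h x)"

(* prox s h is the proximal map of the function s * h. For convex h and s \<ge> 0 the
   objective has exactly one minimiser, so that arg_min involves no choice. *)
definition prox :: "real \<Rightarrow> (real^'n \<Rightarrow> real) \<Rightarrow> real^'n \<Rightarrow> real^'n" where
  "prox s h w = (ARG_MIN (\<lambda>x. s * h x + 1/2 * (norm (x - w))\<^sup>2) x. True)"

definition prox_corr ::
  "(real^'n \<Rightarrow> real) \<Rightarrow> (real^'n \<Rightarrow> real) \<Rightarrow> real^'n \<Rightarrow> real \<Rightarrow> real" where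
  "prox_corr h g x t' = x \<bullet> prox \<bar>t'\<bar> h (x - t' *\<^sub>R riemannian_grad g x)"

(* Meaningful only where prox_corr h g x t' is nonzero. *)
definition step_size ::
  "(real^'n \<Rightarrow> real) \<Rightarrow> (real^'n \<Rightarrow> real) \<Rightarrow> real^'n \<Rightarrow> real \<Rightarrow> real" where
  "step_size h g x t' = t' / prox_corr h g x t'"

(* Extended-real division gives 1 / 0 = \<infinity>. *)
definition proxy_range :: "(real^'n \<Rightarrow> real) \<Rightarrow> real^'n \<Rightarrow> real set" where
  "proxy_range h x = {t'. ereal \<bar>t'\<bar> < 1 / ereal (h x)}"

end

theory Submission
  imports Defs
begin

text \<open>
  Comparing the minimiser \<open>p\<close> defining \<open>c(t')\<close> with \<open>p + \<epsilon> x\<^sub>k\<close> and letting \<open>\<epsilon>\<close> tend to 0 gives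
  \<open>c(t') \<ge> 1 - \<bar>t'\<bar> h(x\<^sub>k) > 0\<close>. For monotonicity let \<open>s = \<bar>t'\<bar> > 0\<close> and let \<open>d\<close> be the Riemannian
  gradient. By homogeneity \<open>p / s\<close> is a proximal point of \<open>h\<close> at \<open>x\<^sub>k / s \<mp> d\<close>, and
  the proximal map is monotone, so \<open>x\<^sub>k \<bullet> p / s = c / s\<close> is increasing in \<open>1 / s\<close>: in other words
  \<open>s / c\<close> is increasing in \<open>s\<close> on each side of 0.
\<close>

text \<open>The origin, where \<open>h\<close> vanishes, is the midpoint of \<open>x\<close> and
  \<open>- x\<close>, where \<open>h\<close> takes equal values.\<close>

lemma convex_absolutely_homogeneous_nonneg:
  assumes "convex_on UNIV h" "absolutely_homogeneous h"
  shows "h x \<ge> 0"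
proof -
  have "h ((1/2) *\<^sub>R x + (1/2) *\<^sub>R (- x)) \<le> 1/2 * h x + 1/2 * h (- x)"
    using assms(1) unfolding convex_on_def by (metis UNIV_I field_sum_of_halves less_eq_real_def
        half_gt_zero zero_less_one)
  moreover have "h (- x) = h x" "h 0 = 0"
    using assms(2)[unfolded absolutely_homogeneous_def, rule_format, of "-1" x]
      assms(2)[unfolded absolutely_homogeneous_def, rule_format, of 0 0] by auto
  ultimately show ?thesis by simp
qed

lemma convex_absolutely_homogeneous_subadditive:
  assumes "convex_on UNIV h" "absolutely_homogeneous h"
  shows "h (x + y) \<le> h x + h y"
proof -
  have "h ((1/2) *\<^sub>R (2 *\<^sub>R x) + (1/2) *\<^sub>R (2 *\<^sub>R y)) \<le> 1/2 * h (2 *\<^sub>R x) + 1/2 * h (2 *\<^sub>R y)"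
    using assms(1) unfolding convex_on_def by (metis UNIV_I field_sum_of_halves less_eq_real_def
        half_gt_zero zero_less_one)
  moreover have "h (2 *\<^sub>R v) = 2 * h v" for v
    using assms(2) by (simp add: absolutely_homogeneous_def)
  ultimately show ?thesis by simp
qed

lemma prox_exists:
  fixes h :: "real^'n \<Rightarrow> real"
  assumes "continuous_on UNIV h" "\<And>x. h x \<ge> 0" "s \<ge> 0"
  shows "\<exists>p. \<forall>y. s * h p + 1/2 * (norm (p - w))\<^sup>2 \<le> s * h y + 1/2 * (norm (y - w))\<^sup>2"
proof -
  let ?F = "\<lambda>x. s * h x + 1/2 * (norm (x - w))\<^sup>2"
  \<comment> \<open>Outside this ball the quadratic term alone is at least the objective at the
    centre \<open>w\<close>, so a minimum over the compact ball is global.\<close>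
  define R where "R = sqrt (2 * ?F w)"
  have R: "R \<ge> 0" "R\<^sup>2 = 2 * ?F w" using assms(2,3) by (auto simp: R_def)
  have "continuous_on (cball w R) ?F"
    by (intro continuous_intros continuous_on_subset[OF assms(1)]) auto
  then obtain p where p: "p \<in> cball w R" "\<And>y. y \<in> cball w R \<Longrightarrow> ?F p \<le> ?F y"
    using continuous_attains_inf[of "cball w R" ?F] R by fastforce
  have "?F p \<le> ?F y" for y
  proof (cases "y \<in> cball w R")
    case False
    then have "R\<^sup>2 \<le> (norm (y - w))\<^sup>2"
      using R by (intro power_mono) (auto simp: dist_norm norm_minus_commute)
    moreover have "?F p \<le> R\<^sup>2 / 2" using p(2)[of w] R by simp
    moreover have "s * h y \<ge> 0" using assms(2,3) by simp
    ultimately show ?thesis by simp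
  qed (use p in auto)
  then show ?thesis by blast
qed

text \<open>\<open>ARG_MIN\<close> is a choice operator and says nothing until some minimiser is
  exhibited. Convexity on a finite-dimensional space gives the continuity that existence rests
  on.\<close>

lemma prox_le:
  fixes h :: "real^'n \<Rightarrow> real"
  assumes "convex_on UNIV h" "absolutely_homogeneous h" "s \<ge> 0"
  shows "s * h (prox s h w) + 1/2 * (norm (prox s h w - w))\<^sup>2
    \<le> s * h y + 1/2 * (norm (y - w))\<^sup>2"
proof -
  have "continuous_on UNIV h"
    using convex_on_continuous[OF open_UNIV assms(1)] .
  from prox_exists[OF this convex_absolutely_homogeneous_nonneg[OF assms(1,2)] assms(3)]
  obtain p where "\<And>y. s * h p + 1/2 * (norm (p - w))\<^sup>2 \<le> s * h y + 1/2 * (norm (y - w))\<^sup>2"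
    by blast
  then have "is_arg_min (\<lambda>x. s * h x + 1/2 * (norm (x - w))\<^sup>2) (\<lambda>_. True) p"
    by (simp add: is_arg_min_linorder)
  then have "is_arg_min (\<lambda>x. s * h x + 1/2 * (norm (x - w))\<^sup>2) (\<lambda>_. True) (prox s h w)"
    unfolding prox_def arg_min_def by (rule someI)
  then show ?thesis by (simp add: is_arg_min_linorder)
qed

lemma prox_inner_ge:
  fixes h :: "real^'n \<Rightarrow> real"
  assumes "convex_on UNIV h" "absolutely_homogeneous h" "s \<ge> 0"
  shows "x \<bullet> w - s * h x \<le> x \<bullet> prox s h w"
proof (rule ccontr)
  define p where "p = prox s h w"
  define \<delta> where "\<delta> = x \<bullet> w - s * h x - x \<bullet> p"
  assume "\<not> ?thesis"
  then have \<delta>: "\<delta> > 0" by (simp add: \<delta>_def p_def)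
  \<comment> \<open>Moving from the minimiser \<open>p\<close> to \<open>p + e *\<^sub>R x\<close>
    costs at most \<open>s * e * h x\<close> in the first term, by subadditivity. The part of the
    total change linear in \<open>e\<close> is then \<open>- e * \<delta>\<close>.\<close>
  have ineq: "e * \<delta> \<le> e\<^sup>2 / 2 * (x \<bullet> x)" if "e > 0" for e
  proof -
    have "h (p + e *\<^sub>R x) \<le> h p + e * h x"
      using convex_absolutely_homogeneous_subadditive[OF assms(1,2), of p "e *\<^sub>R x"] assms(2) that
      by (simp add: absolutely_homogeneous_def)
    then have "s * h (p + e *\<^sub>R x) \<le> s * h p + s * (e * h x)"
      using assms(3) by (metis distrib_left mult_left_mono)
    moreover have "s * h p + 1/2 * (norm (p - w))\<^sup>2
        \<le> s * h (p + e *\<^sub>R x) + 1/2 * (norm (p + e *\<^sub>R x - w))\<^sup>2"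
      unfolding p_def by (rule prox_le[OF assms])
    moreover have "(norm (p + e *\<^sub>R x - w))\<^sup>2
        = (norm (p - w))\<^sup>2 + 2 * e * (x \<bullet> p - x \<bullet> w) + e\<^sup>2 * (x \<bullet> x)"
      unfolding power2_norm_eq_inner
      by (simp add: algebra_simps inner_commute power2_eq_square)
    ultimately show ?thesis by (simp add: \<delta>_def algebra_simps)
  qed
  \<comment> \<open>One small \<open>e\<close> replaces the limit:
    \<open>e * (x \<bullet> x) < \<delta>\<close> already contradicts \<open>ineq\<close>. The
    summand 1 keeps the denominator positive even for \<open>x = 0\<close>.\<close>
  define e where "e = \<delta> / (x \<bullet> x + 1)"
  have "x \<bullet> x + 1 > 0" by (simp add: add_nonneg_pos)
  then have e: "e > 0" "e * (x \<bullet> x + 1) = \<delta>" using \<delta> by (auto simp: e_def)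
  have "e * \<delta> \<le> e * (e / 2 * (x \<bullet> x))"
    using ineq[OF e(1)] by (simp add: power2_eq_square mult_ac)
  then have "\<delta> \<le> e / 2 * (x \<bullet> x)" using e(1) by simp
  also have "\<dots> \<le> e * (x \<bullet> x)" using e(1) by (intro mult_right_mono) auto
  also have "\<dots> < \<delta>" using e by (simp add: distrib_left)
  finally show False by simp
qed

text \<open>Substituting \<open>s *\<^sub>R v\<close> for the variable multiplies the whole
  objective by \<open>s\<^sup>2\<close>. This brings all step-sizes to the same weight 1 on
  \<open>h\<close>, so that their minimisers can be compared.\<close>

lemma prox_scaled_le:
  fixes h :: "real^'n \<Rightarrow> real" and u :: "real^'n"
  assumes "convex_on UNIV h" "absolutely_homogeneous h" "s > 0"
  defines "z \<equiv> prox s h (s *\<^sub>R u) /\<^sub>R s"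
  shows "h z + 1/2 * (norm (z - u))\<^sup>2 \<le> h y + 1/2 * (norm (y - u))\<^sup>2"
proof -
  have scale: "s * h (s *\<^sub>R v) + 1/2 * (norm (s *\<^sub>R v - s *\<^sub>R u))\<^sup>2
      = s\<^sup>2 * (h v + 1/2 * (norm (v - u))\<^sup>2)" for v
  proof -
    have "h (s *\<^sub>R v) = s * h v"
      using assms(2,3) by (simp add: absolutely_homogeneous_def)
    moreover have "norm (s *\<^sub>R v - s *\<^sub>R u) = s * norm (v - u)"
      using assms(3) by (simp flip: scaleR_diff_right)
    ultimately show ?thesis by (simp add: power2_eq_square algebra_simps)
  qed
  have "s *\<^sub>R z = prox s h (s *\<^sub>R u)" using assms(3) by (simp add: z_def)
  then have "s\<^sup>2 * (h z + 1/2 * (norm (z - u))\<^sup>2) \<le> s\<^sup>2 * (h y + 1/2 * (norm (y - u))\<^sup>2)"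
    using prox_le[OF assms(1,2), of s "s *\<^sub>R u" "s *\<^sub>R y"] assms(3) scale[of z] scale[of y]
    by simp
  then show ?thesis using assms(3) by simp
qed

text \<open>Adding the two inequalities cancels the values of \<open>h\<close> and the squared
  norms; only the cross terms remain.\<close>

lemma minimisers_monotone:
  fixes h :: "'a::real_inner \<Rightarrow> real"
  assumes "h z\<^sub>1 + 1/2 * (norm (z\<^sub>1 - u\<^sub>1))\<^sup>2 \<le> h z\<^sub>2 + 1/2 * (norm (z\<^sub>2 - u\<^sub>1))\<^sup>2"
    and "h z\<^sub>2 + 1/2 * (norm (z\<^sub>2 - u\<^sub>2))\<^sup>2 \<le> h z\<^sub>1 + 1/2 * (norm (z\<^sub>1 - u\<^sub>2))\<^sup>2"
  shows "(u\<^sub>1 - u\<^sub>2) \<bullet> (z\<^sub>1 - z\<^sub>2) \<ge> 0"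
  using assms unfolding power2_norm_eq_inner
  by (simp add: algebra_simps inner_commute)

lemma prox_corr_quotient_antimono:
  fixes h g :: "real^'n \<Rightarrow> real"
  assumes "convex_on UNIV h" "absolutely_homogeneous h"
    and "t\<^sub>1 * t\<^sub>2 > 0" and "\<bar>t\<^sub>1\<bar> < \<bar>t\<^sub>2\<bar>"
  shows "prox_corr h g x t\<^sub>2 / \<bar>t\<^sub>2\<bar> \<le> prox_corr h g x t\<^sub>1 / \<bar>t\<^sub>1\<bar>"
proof -
  define d where "d = riemannian_grad g x"
  define u where "u t = x /\<^sub>R \<bar>t\<bar> - sgn t *\<^sub>R d" for t
  define z where "z t = prox \<bar>t\<bar> h (\<bar>t\<bar> *\<^sub>R u t) /\<^sub>R \<bar>t\<bar>" for t
  have nz: "t\<^sub>1 \<noteq> 0" "t\<^sub>2 \<noteq> 0" and sgn: "sgn t\<^sub>1 = sgn t\<^sub>2"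
    using assms(3) by (auto simp: zero_less_mult_iff)
  have corr: "x \<bullet> z t = prox_corr h g x t / \<bar>t\<bar>" if "t \<noteq> 0" for t
  proof -
    have "\<bar>t\<bar> *\<^sub>R u t = x - t *\<^sub>R d"
      using that by (simp add: u_def scaleR_diff_right abs_mult_sgn)
    then show ?thesis by (simp add: z_def prox_corr_def d_def divide_inverse mult.commute)
  qed
  have "h (z t) + 1/2 * (norm (z t - u t))\<^sup>2 \<le> h y + 1/2 * (norm (y - u t))\<^sup>2"
    if "t \<noteq> 0" for t y
    unfolding z_def using prox_scaled_le[OF assms(1,2)] that by simp
  then have "(u t\<^sub>1 - u t\<^sub>2) \<bullet> (z t\<^sub>1 - z t\<^sub>2) \<ge> 0"
    using nz by (intro minimisers_monotone)
  \<comment> \<open>Equal signs make the gradient terms cancel, so the monotonicity inequality sees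
    the minimisers only through their inner products with \<open>x\<close>.\<close>
  moreover have "u t\<^sub>1 - u t\<^sub>2 = (1 / \<bar>t\<^sub>1\<bar> - 1 / \<bar>t\<^sub>2\<bar>) *\<^sub>R x"
    by (simp add: u_def sgn scaleR_diff_left inverse_eq_divide)
  ultimately have "(1 / \<bar>t\<^sub>1\<bar> - 1 / \<bar>t\<^sub>2\<bar>) * (x \<bullet> z t\<^sub>1 - x \<bullet> z t\<^sub>2) \<ge> 0"
    by (simp add: inner_diff_right right_diff_distrib)
  moreover have "1 / \<bar>t\<^sub>1\<bar> - 1 / \<bar>t\<^sub>2\<bar> > 0"
    using nz assms(4) by (simp add: frac_less2)
  ultimately show ?thesis
    using corr nz by (simp add: zero_le_mult_iff)
qed

lemma prox_corr_pos:
  fixes h g :: "real^'n \<Rightarrow> real"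
  assumes "convex_on UNIV h" "absolutely_homogeneous h" "norm x = 1" "t \<in> proxy_range h x"
  shows "prox_corr h g x t > 0"
proof -
  have "x \<bullet> x = 1" using assms(3) by (simp add: dot_square_norm)
  \<comment> \<open>The Riemannian gradient is orthogonal to \<open>x\<close> on the unit
    sphere.\<close>
  then have "x \<bullet> (x - t *\<^sub>R riemannian_grad g x) = 1"
    by (simp add: riemannian_grad_eq inner_diff_right)
  then have "1 - \<bar>t\<bar> * h x \<le> prox_corr h g x t"
    unfolding prox_corr_def
    using prox_inner_ge[OF assms(1,2), of "\<bar>t\<bar>" x "x - t *\<^sub>R riemannian_grad g x"] by simp
  moreover have "\<bar>t\<bar> * h x < 1"
  \<comment> \<open>If \<open>h x = 0\<close>, the range is the whole line and the bound reads
    \<open>0 < 1\<close>; otherwise the extended-real quotient is an ordinary one.\<close>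
  proof (cases "h x = 0")
    case False
    then have "h x > 0"
      using convex_absolutely_homogeneous_nonneg[OF assms(1,2), of x] by simp
    then show ?thesis
      using assms(4) by (simp add: proxy_range_def one_ereal_def pos_less_divide_eq)
  qed simp
  ultimately show ?thesis by linarith
qed

lemma step_size_mono:
  fixes h g :: "real^'n \<Rightarrow> real"
  assumes "convex_on UNIV h" "absolutely_homogeneous h" "norm x = 1"
    and "t\<^sub>1 \<in> proxy_range h x" "t\<^sub>2 \<in> proxy_range h x" "t\<^sub>1 \<le> t\<^sub>2"
  shows "step_size h g x t\<^sub>1 \<le> step_size h g x t\<^sub>2"
proof -
  let ?c = "prox_corr h g x"
  have c: "?c t\<^sub>1 > 0" "?c t\<^sub>2 > 0"
    using prox_corr_pos assms by blast+
  \<comment> \<open>Across 0 the signs of the step-sizes decide. On either side of 0 the quotient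
    lemma applies, and taking reciprocals of positive quotients reverses its inequality.\<close>
  consider "t\<^sub>1 = t\<^sub>2" | "t\<^sub>1 \<le> 0" "0 \<le> t\<^sub>2" | "0 < t\<^sub>1" "t\<^sub>1 < t\<^sub>2" | "t\<^sub>2 < 0" "t\<^sub>1 < t\<^sub>2"
    using assms(6) by linarith
  then show ?thesis
  proof cases
    case 1
    then show ?thesis by simp
  next
    case 2
    then have "t\<^sub>1 / ?c t\<^sub>1 \<le> 0" "0 \<le> t\<^sub>2 / ?c t\<^sub>2"
      using c by (auto simp: divide_nonpos_pos)
    then show ?thesis by (simp add: step_size_def)
  next
    case 3
    then have "?c t\<^sub>2 / t\<^sub>2 \<le> ?c t\<^sub>1 / t\<^sub>1"
      using prox_corr_quotient_antimono[OF assms(1,2), of t\<^sub>1 t\<^sub>2 g x] by simp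
    then show ?thesis using 3 c by (simp add: step_size_def field_simps)
  next
    case 4
    \<comment> \<open>For negative arguments \<open>t\<^sub>1\<close> has the larger absolute value,
      so the two exchange roles.\<close>
    then have "?c t\<^sub>1 / - t\<^sub>1 \<le> ?c t\<^sub>2 / - t\<^sub>2"
      using prox_corr_quotient_antimono[OF assms(1,2), of t\<^sub>2 t\<^sub>1 g x]
      by (simp add: mult_neg_neg)
    then show ?thesis using 4 c by (simp add: step_size_def field_simps)
  qed
qed

theorem theorem1:
  fixes h g :: "real^'n \<Rightarrow> real" and x\<^sub>k :: "real^'n"
  assumes "convex_on UNIV h"
    and "absolutely_homogeneous h"
    and "smooth g"
    and "x\<^sub>k \<in> sphere 0 1"
  shows "(\<forall>t' \<in> proxy_range h x\<^sub>k. prox_corr h g x\<^sub>k t' \<noteq> 0)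
    \<and> (\<forall>t\<^sub>1 \<in> proxy_range h x\<^sub>k. \<forall>t\<^sub>2 \<in> proxy_range h x\<^sub>k.
         (step_size h g x\<^sub>k t\<^sub>1 - step_size h g x\<^sub>k t\<^sub>2) * (t\<^sub>1 - t\<^sub>2) \<ge> 0)
    \<and> step_size h g x\<^sub>k 0 = 0"
proof (intro conjI ballI)
  have x: "norm x\<^sub>k = 1" using assms(4) by simp
  \<comment> \<open>As division by 0 yields 0 in HOL, this conjunct certifies that
    \<open>step_size\<close> is a genuine quotient throughout the range.\<close>
  show "prox_corr h g x\<^sub>k t' \<noteq> 0" if "t' \<in> proxy_range h x\<^sub>k" for t'
    using prox_corr_pos[OF assms(1,2) x that] by (simp add: less_imp_neq[symmetric])
  show "(step_size h g x\<^sub>k t\<^sub>1 - step_size h g x\<^sub>k t\<^sub>2) * (t\<^sub>1 - t\<^sub>2) \<ge> 0"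
    if "t\<^sub>1 \<in> proxy_range h x\<^sub>k" "t\<^sub>2 \<in> proxy_range h x\<^sub>k" for t\<^sub>1 t\<^sub>2
    using step_size_mono[OF assms(1,2) x that, of g] step_size_mono[OF assms(1,2) x that(2,1), of g]
    by (cases "t\<^sub>1 \<le> t\<^sub>2") (simp_all add: zero_le_mult_iff)
  show "step_size h g x\<^sub>k 0 = 0" by (simp add: step_size_def)
qed

end
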